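(* Let $J$ be an infinite set, $\lambda=(\lambda_j)_{j\in J}\in\mathbb{R}^J$ and $\chi=(d_j)_{j\in J}\in\mathbb{R}^J$. Let $X\in\{A,B\}$ and $W=W(X_J)$. The following are equivalent: (1) $\inf\lambda(W.\chi-\chi)=0$, i.e. $\lambda(w.\chi-\chi)\geq0$ for all $w\in W$. (2) $\chi\in C_{\min}(\lambda,X_J)$.
   Context: Elements $\chi=(d_j)_{j\in J}$ of $\mathbb{R}^J$ are written as formal sums $\sum_{j\in J}d_je_j$, and $\mathbb{R}^{(J)}\subseteq\mathbb{R}^J$ is the space of finitely supported tuples, with basis $(e_j)_{j\in J}$. $S_{(J)}$ is the group of permutations of $J$ moving only finitely many elements, acting on $\mathbb{R}^J$ by $w(\sum_jd_je_j)=\sum_jd_je_{w(j)}$. $\{\pm1\}^{(J)}$ is the group of sign tuples $\sigma=(\sigma_j)_{j\in J}$ with $\sigma_j=-1$ for only finitely many $j$, acting on $\mathbb{R}^J$ by componentwise multiplication. $W(A_J)=S_{(J)}$ and $W(B_J)=S_{(J)}\ltimes\{\pm1\}^{(J)}$, as groups of linear maps of $\mathbb{R}^J$. For $w\in W$, $w.\chi-\chi\in\mathbb{R}^{(J)}$, and $\lambda$ is viewed as the linear functional $\mathbb{R}^{(J)}\to\mathbb{R}$, $e_j\mapsto\lambda_j$; explicitly, $\lambda(\sigma w^{-1}.\chi-\chi)=\sum_{j\in J}\lambda_j(\sigma_jd_{w(j)}-d_j)$ for $w\in S_{(J)}$, $\sigma\in\{\pm1\}^{(J)}$. $\lambda(W.\chi-\chi)$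 denotes $\{\lambda(w.\chi-\chi): w\in W\}$. $C_{\min}(\lambda,A_J)=\{(d_j)_{j\in J}\in\mathbb{R}^J : \forall i,j\in J,\ \lambda_i<\lambda_j\Rightarrow d_i\geq d_j\}$. $C_{\min}(\lambda,B_J)=\{(d_j)_{j\in J}\in\mathbb{R}^J : \forall j\in J,\ \lambda_jd_j\leq0,\ \text{and}\ \forall i,j\in J,\ |\lambda_i|<|\lambda_j|\Rightarrow|d_i|\leq|d_j|\}$. *)

theory Defs
  imports "HOL-Combinatorics.Permutations" "HOL-Library.Extended_Real"
begin

(* A tuple in R^J is a function 'j => real of which only the values on J matter.
   The groups below act as the identity on coordinates outside J, and the pairing and
   the sets C_min only look at coordinates in J. *)

definition fin_perms :: "'j set \<Rightarrow> ('j \<Rightarrow> 'j) set" where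
  "fin_perms J = {w. w permutes J \<and> finite {j. w j \<noteq> j}}"

definition fin_signs :: "'j set \<Rightarrow> ('j \<Rightarrow> real) set" where
  "fin_signs J = {\<sigma>. (\<forall>j. \<sigma> j \<in> {1, -1}) \<and> finite {j. \<sigma> j = -1} \<and> {j. \<sigma> j = -1} \<subseteq> J}"

(* w (sum_j d_j e_j) = sum_j d_j e_(w j), so coordinate w j of the image is d_j. *)
definition perm_act :: "('j \<Rightarrow> 'j) \<Rightarrow> ('j \<Rightarrow> real) \<Rightarrow> ('j \<Rightarrow> real)" where
  "perm_act w d = (\<lambda>k. d (inv w k))"

definition sign_act :: "('j \<Rightarrow> real) \<Rightarrow> ('j \<Rightarrow> real) \<Rightarrow> ('j \<Rightarrow> real)" where
  "sign_act \<sigma> d = (\<lambda>j. \<sigma> j * d j)"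

datatype root_type = Type_A | Type_B

(* In type B, every element of the semidirect product factors as a sign change after
   a permutation. *)
fun weyl_group :: "root_type \<Rightarrow> 'j set \<Rightarrow> (('j \<Rightarrow> real) \<Rightarrow> ('j \<Rightarrow> real)) set" where
  "weyl_group Type_A J = {perm_act w | w. w \<in> fin_perms J}"
| "weyl_group Type_B J = {sign_act \<sigma> \<circ> perm_act w | \<sigma> w. \<sigma> \<in> fin_signs J \<and> w \<in> fin_perms J}"

fun C_min :: "root_type \<Rightarrow> 'j set \<Rightarrow> ('j \<Rightarrow> real) \<Rightarrow> ('j \<Rightarrow> real) set" where
  "C_min Type_A J l = {d. \<forall>i\<in>J. \<forall>j\<in>J. l i < l j \<longrightarrow> d i \<ge> d j}"
| "C_min Type_B J l = {d. (\<forall>j\<in>J. l j * d j \<le> 0) \<and>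
      (\<forall>i\<in>J. \<forall>j\<in>J. \<bar>l i\<bar> < \<bar>l j\<bar> \<longrightarrow> \<bar>d i\<bar> \<le> \<bar>d j\<bar>)}"

(* The functional e_j |-> l_j on finitely supported tuples; it is only meaningful for v
   with finitely many nonzero coordinates in J, see finite_support_weyl_diff. *)
definition pairing :: "'j set \<Rightarrow> ('j \<Rightarrow> real) \<Rightarrow> ('j \<Rightarrow> real) \<Rightarrow> real" where
  "pairing J l v = (\<Sum>j\<in>{j\<in>J. v j \<noteq> 0}. l j * v j)"

definition weyl_diff :: "(('j \<Rightarrow> real) \<Rightarrow> ('j \<Rightarrow> real)) \<Rightarrow> ('j \<Rightarrow> real) \<Rightarrow> ('j \<Rightarrow> real)" where
  "weyl_diff g d = (\<lambda>j. g d j - d j)"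

lemma finite_support_weyl_diff:
  assumes "g \<in> weyl_group X J"
  shows "finite {j\<in>J. weyl_diff g d j \<noteq> 0}"
proof -
  have inv_fix: "inv w j = j" if "w \<in> fin_perms J" "w j = j" for w and j :: 'a
    using that permutes_inverses(2)[of w J j] by (simp add: fin_perms_def)
  show ?thesis
  proof (cases X)
    case Type_A
    then obtain w where w: "w \<in> fin_perms J" "g = perm_act w"
      using assms by auto
    have "{j\<in>J. weyl_diff g d j \<noteq> 0} \<subseteq> {j. w j \<noteq> j}"
      using inv_fix[OF w(1)] by (auto simp: w(2) weyl_diff_def perm_act_def)
    then show ?thesis
      using w(1) finite_subset by (auto simp: fin_perms_def)
  next
    case Type_B
    then obtain \<sigma> w where w: "\<sigma> \<in> fin_signs J" "w \<in> fin_perms J" "g = sign_act \<sigma> \<circ> perm_act w"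
      using assms by auto
    have "{j\<in>J. weyl_diff g d j \<noteq> 0} \<subseteq> {j. w j \<noteq> j} \<union> {j. \<sigma> j = -1}"
      using inv_fix[OF w(2)] w(1)
      by (fastforce simp: w(3) weyl_diff_def perm_act_def sign_act_def fin_signs_def)
    moreover have "finite ({j. w j \<noteq> j} \<union> {j. \<sigma> j = -1})"
      using w(1,2) by (simp add: fin_perms_def fin_signs_def)
    ultimately show ?thesis
      by (rule finite_subset)
  qed
qed

end

theory Submission
  imports Defs
begin

text \<open>
  Sufficiency is the rearrangement inequality on a finite set carrying the support of a group
  element; in type B it is applied to \<open>\<bar>l\<bar>\<close> and \<open>- \<bar>d\<bar>\<close>, since
  \<open>l\<^sub>j \<sigma>\<^sub>j d\<^sub>k \<ge> - \<bar>l\<^sub>j\<bar> \<bar>d\<^sub>k\<bar>\<close>, with equality for \<open>\<sigma>\<^sub>j = 1\<close>, \<open>k = j\<close> when \<open>l\<^sub>j d\<^sub>j \<le> 0\<close>.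
  Necessity is tested on transpositions, in type B also on single sign changes and on
  transpositions with the two signs chosen so that both summands become nonpositive.
\<close>

text \<open>Pairing a largest weight with a smallest value can only lower the sum. One exchange of
  values brings this about at a single index, and the induction hypothesis handles the remaining
  indices.\<close>

lemma rearrangement_inequality:
  fixes l d :: "'a \<Rightarrow> 'b::linordered_idom"
  assumes "finite F" "w permutes F"
    and "\<And>i j. i \<in> F \<Longrightarrow> j \<in> F \<Longrightarrow> l i < l j \<Longrightarrow> d j \<le> d i"
  shows "(\<Sum>j\<in>F. l j * d j) \<le> (\<Sum>j\<in>F. l j * d (w j))"
  using assms
proof (induction F arbitrary: w rule: finite_psubset_induct)
  case (psubset F)
  show ?case
  proof (cases "F = {}")
    case False
    \<comment> \<open>The hypothesis says nothing about indices of equal weight. Hence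
      \<open>m\<close> is taken with minimal \<open>d\<close> among the indices of maximal weight;
      indices of smaller weight have \<open>d\<close> at least \<open>d m\<close> by the
      hypothesis.\<close>
    define M where "M = {i \<in> F. l i = Max (l ` F)}"
    have "Max (l ` F) \<in> l ` F"
      using False psubset.hyps by simp
    then have "finite M" "M \<noteq> {}"
      using psubset.hyps by (auto simp: M_def)
    then obtain m where "m \<in> M" and m_min: "\<And>i. i \<in> M \<Longrightarrow> d m \<le> d i"
      using arg_min_if_finite[of M d] by (meson not_le)
    then have m: "m \<in> F" and lm: "l m = Max (l ` F)"
      by (auto simp: M_def)
    have l_le: "l i \<le> l m" if "i \<in> F" for i
      using that psubset.hyps lm by simp
    have d_ge: "d m \<le> d i" if "i \<in> F" for i
    proof (cases "l i = l m")
      case True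
      then show ?thesis
        using m_min[of i] that lm by (simp add: M_def)
    next
      case False
      then show ?thesis
        using l_le[OF that] psubset.prems(2)[OF that m] by simp
    qed
    define k where "k = inv w m"
    have wk: "w k = m" and k: "k \<in> F"
      using psubset.prems(1) m permutes_inverses(1) permutes_in_image[OF permutes_inv]
      unfolding k_def by metis+
    \<comment> \<open>Exchanging the values that \<open>w\<close> takes at \<open>m\<close> and
      \<open>k\<close> makes \<open>m\<close> a fixed point, so the result restricts to
      \<open>F - {m}\<close>.\<close>
    define w' where "w' = w \<circ> transpose m k"
    have w': "w' permutes F"
      unfolding w'_def using psubset.prems(1) m k
      by (intro permutes_compose[OF permutes_swap_id]) auto
    have w'm: "w' m = m" and w'k: "w' k = w m"
      and w'_other: "\<And>j. j \<noteq> m \<Longrightarrow> j \<noteq> k \<Longrightarrow> w' j = w j"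
      by (auto simp: w'_def wk)
    have "w' permutes F - {m}"
      using w' w'm by (auto intro: permutes_superset)
    then have "(\<Sum>j\<in>F - {m}. l j * d j) \<le> (\<Sum>j\<in>F - {m}. l j * d (w' j))"
      using m psubset.prems(2) by (intro psubset.IH) auto
    then have "(\<Sum>j\<in>F. l j * d j) \<le> (\<Sum>j\<in>F. l j * d (w' j))"
      using psubset.hyps m by (simp add: sum.remove[of F m] w'm)
    also have "\<dots> \<le> (\<Sum>j\<in>F. l j * d (w j))"
    proof (cases "k = m")
      case True
      then show ?thesis
        by (simp add: w'_def)
    next
      case False
      have split: "(\<Sum>j\<in>F. f j) = f m + (f k + (\<Sum>j\<in>F - {m} - {k}. f j))"
        for f :: "'a \<Rightarrow> 'b"
        using psubset.hyps m k False by (simp add: sum.remove[of F m] sum.remove[of "F - {m}" k])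
      have "w m \<in> F"
        using psubset.prems(1) m by (simp add: permutes_in_image)
      \<comment> \<open>This product is exactly the sum for \<open>w\<close> minus the sum for
        \<open>w'\<close>, since they differ only at \<open>m\<close> and \<open>k\<close>.\<close>
      then have "0 \<le> (l m - l k) * (d (w m) - d m)"
        using l_le[OF k] d_ge by simp
      moreover have "(\<Sum>j\<in>F - {m} - {k}. l j * d (w' j)) = (\<Sum>j\<in>F - {m} - {k}. l j * d (w j))"
        by (intro sum.cong) (auto simp: w'_other)
      ultimately show ?thesis
        unfolding split by (simp add: w'm w'k wk algebra_simps)
    qed
    finally show ?thesis .
  qed simp
qed

lemma pairing_eq_sum:
  assumes "finite G" "G \<subseteq> J" "\<And>j. j \<in> J \<Longrightarrow> j \<notin> G \<Longrightarrow> v j = 0"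
  shows "pairing J l v = (\<Sum>j\<in>G. l j * v j)"
  unfolding pairing_def using assms by (intro sum.mono_neutral_left) auto

text \<open>Type A elements become signed permutations with trivial signs, so the same pairing
  formulas serve both types.\<close>

lemma perm_act_eq_signed: "perm_act w = sign_act (\<lambda>_. 1) \<circ> perm_act w"
  by (auto simp: sign_act_def)

lemma one_in_fin_signs: "(\<lambda>_. 1) \<in> fin_signs J"
  by (simp add: fin_signs_def)

lemma id_in_fin_perms: "id \<in> fin_perms J"
  by (simp add: fin_perms_def permutes_id)

lemma transpose_in_fin_perms:
  assumes "i \<in> J" "j \<in> J"
  shows "transpose i j \<in> fin_perms J"
proof -
  have "{k. transpose i j k \<noteq> k} \<subseteq> {i, j}"
    by (auto simp: transpose_def)
  then show ?thesis
    using assms by (auto simp: fin_perms_def permutes_swap_id intro: finite_subset)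
qed

text \<open>The support of the difference need not be stable under \<open>w\<close>, because
  \<open>d\<close> may repeat values. The set of indices moved by \<open>w\<close> or carrying a
  sign -1 is finite, contains that support and is permuted by \<open>w\<close>, as rearrangement
  requires.\<close>

lemma pairing_signed_perm:
  assumes "\<sigma> \<in> fin_signs J" "w \<in> fin_perms J"
  obtains G where "finite G" "G \<subseteq> J" "inv w permutes G"
    "pairing J l (weyl_diff (sign_act \<sigma> \<circ> perm_act w) d)
      = (\<Sum>j\<in>G. l j * (\<sigma> j * d (inv w j) - d j))"
proof
  let ?G = "{j. w j \<noteq> j} \<union> {j. \<sigma> j = -1}"
  show G: "finite ?G" "?G \<subseteq> J"
    using assms by (auto simp: fin_signs_def fin_perms_def permutes_def)
  have "w permutes J"
    using assms by (simp add: fin_perms_def)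
  then have "w permutes ?G"
    by (auto intro: permutes_superset)
  then show inv: "inv w permutes ?G"
    by (rule permutes_inv)
  have "\<sigma> j = 1" if "j \<notin> ?G" for j
    using assms that by (auto simp: fin_signs_def)
  then show "pairing J l (weyl_diff (sign_act \<sigma> \<circ> perm_act w) d)
      = (\<Sum>j\<in>?G. l j * (\<sigma> j * d (inv w j) - d j))"
    using G permutes_not_in[OF inv]
    by (subst pairing_eq_sum[OF G]) (auto simp: weyl_diff_def sign_act_def perm_act_def)
qed

lemma pairing_signed_transpose:
  assumes "i \<in> J" "j \<in> J" "i \<noteq> j" "\<And>k. k \<noteq> i \<Longrightarrow> k \<noteq> j \<Longrightarrow> \<sigma> k = 1"
  shows "pairing J l (weyl_diff (sign_act \<sigma> \<circ> perm_act (transpose i j)) d)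
    = l i * (\<sigma> i * d j - d i) + l j * (\<sigma> j * d i - d j)"
  using assms
  by (subst pairing_eq_sum[of "{i, j}"])
     (auto simp: weyl_diff_def sign_act_def perm_act_def)

lemma pairing_sign_change:
  assumes "j \<in> J"
  shows "pairing J l (weyl_diff (sign_act ((\<lambda>_. 1)(j := -1)) \<circ> perm_act id) d) = - 2 * (l j * d j)"
  using assms
  by (subst pairing_eq_sum[of "{j}"])
     (auto simp: weyl_diff_def sign_act_def perm_act_def)

lemma nonneg_iff_C_min_A:
  "(\<forall>g \<in> weyl_group Type_A J. pairing J l (weyl_diff g d) \<ge> 0) \<longleftrightarrow> d \<in> C_min Type_A J l"
    (is "?nonneg \<longleftrightarrow> _")
proof
  assume nonneg: ?nonneg
  have "d j \<le> d i" if "i \<in> J" "j \<in> J" "l i < l j" for i j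
  proof -
    have "perm_act (transpose i j) \<in> weyl_group Type_A J"
      using transpose_in_fin_perms[OF that(1,2)] by auto
    then have "0 \<le> pairing J l (weyl_diff (sign_act (\<lambda>_. 1) \<circ> perm_act (transpose i j)) d)"
      using nonneg perm_act_eq_signed by metis
    also have "\<dots> = l i * (1 * d j - d i) + l j * (1 * d i - d j)"
      using that by (intro pairing_signed_transpose) auto
    \<comment> \<open>The pairing with a transposition factors, and its first factor is positive
      here, so the second is nonnegative.\<close>
    also have "\<dots> = (l j - l i) * (d i - d j)"
      by (simp add: algebra_simps)
    finally show ?thesis
      using that(3) by (simp add: zero_le_mult_iff)
  qed
  then show "d \<in> C_min Type_A J l"
    by simp
next
  assume d: "d \<in> C_min Type_A J l"
  show ?nonneg
  proof
    fix g assume "g \<in> weyl_group Type_A J"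
    then obtain w where w: "w \<in> fin_perms J" "g = sign_act (\<lambda>_. 1) \<circ> perm_act w"
      using perm_act_eq_signed by fastforce
    obtain G where G: "finite G" "G \<subseteq> J" "inv w permutes G"
      and eq: "pairing J l (weyl_diff g d) = (\<Sum>j\<in>G. l j * (1 * d (inv w j) - d j))"
      using pairing_signed_perm[OF one_in_fin_signs w(1)] unfolding w(2) by metis
    have "(\<Sum>j\<in>G. l j * d j) \<le> (\<Sum>j\<in>G. l j * d (inv w j))"
      using d G(2) by (intro rearrangement_inequality[OF G(1,3)]) auto
    then show "0 \<le> pairing J l (weyl_diff g d)"
      by (simp add: eq right_diff_distrib sum_subtractf)
  qed
qed

lemma nonneg_iff_C_min_B:
  "(\<forall>g \<in> weyl_group Type_B J. pairing J l (weyl_diff g d) \<ge> 0) \<longleftrightarrow> d \<in> C_min Type_B J l"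
    (is "?nonneg \<longleftrightarrow> _")
proof
  assume nonneg: ?nonneg
  have sign: "l j * d j \<le> 0" if "j \<in> J" for j
  proof -
    have "{k. k = j} = {j}"
      by auto
    then have "(\<lambda>_. 1)(j := -1) \<in> fin_signs J"
      using that by (auto simp: fin_signs_def)
    then have "sign_act ((\<lambda>_. 1)(j := -1)) \<circ> perm_act id \<in> weyl_group Type_B J"
      using id_in_fin_perms by auto
    then have "0 \<le> - 2 * (l j * d j)"
      using nonneg pairing_sign_change[OF that] by metis
    then show ?thesis
      by linarith
  qed
  have "\<bar>d i\<bar> \<le> \<bar>d j\<bar>" if "i \<in> J" "j \<in> J" "\<bar>l i\<bar> < \<bar>l j\<bar>" for i j
  proof -
    \<comment> \<open>The factor \<open>s x\<close> is opposite in sign to \<open>x\<close>, which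
      makes both cross terms of the signed transposition as small as possible. At 0 it must still be
      1 or -1, which excludes \<open>- sgn x\<close>.\<close>
    define s where "s = (\<lambda>x::real. if 0 \<le> x then -1 else (1::real))"
    define \<sigma> where "\<sigma> = (\<lambda>_. 1)(i := s (l i * d j), j := s (l j * d i))"
    have s: "s x \<in> {1, -1}" "s x * x = - \<bar>x\<bar>" for x
      by (auto simp: s_def)
    have "{k. \<sigma> k = -1} \<subseteq> {i, j}"
      by (auto simp: \<sigma>_def split: if_splits)
    then have "\<sigma> \<in> fin_signs J"
      using that(1,2) s(1) finite_subset[of _ "{i, j}"] by (auto simp: fin_signs_def \<sigma>_def)
    then have "sign_act \<sigma> \<circ> perm_act (transpose i j) \<in> weyl_group Type_B J"
      using transpose_in_fin_perms[OF that(1,2)] by auto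
    then have "0 \<le> pairing J l (weyl_diff (sign_act \<sigma> \<circ> perm_act (transpose i j)) d)"
      using nonneg by blast
    also have "\<dots> = l i * (\<sigma> i * d j - d i) + l j * (\<sigma> j * d i - d j)"
      using that by (intro pairing_signed_transpose) (auto simp: \<sigma>_def)
    also have "\<dots> = s (l i * d j) * (l i * d j) + s (l j * d i) * (l j * d i) - l i * d i - l j * d j"
      using that by (auto simp: \<sigma>_def algebra_simps)
    \<comment> \<open>The sign condition proved first turns the diagonal terms into absolute values;
      only then does the expression factor as in type A.\<close>
    also have "\<dots> = - \<bar>l i * d j\<bar> - \<bar>l j * d i\<bar> + \<bar>l i * d i\<bar> + \<bar>l j * d j\<bar>"
      using sign[OF that(1)] sign[OF that(2)] by (simp add: s(2))
    also have "\<dots> = (\<bar>l j\<bar> - \<bar>l i\<bar>) * (\<bar>d j\<bar> - \<bar>d i\<bar>)"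
      by (simp add: abs_mult algebra_simps)
    finally show ?thesis
      using that(3) by (simp add: zero_le_mult_iff)
  qed
  then show "d \<in> C_min Type_B J l"
    using sign by simp
next
  assume d: "d \<in> C_min Type_B J l"
  show ?nonneg
  proof
    fix g assume "g \<in> weyl_group Type_B J"
    then obtain \<sigma> w where w: "\<sigma> \<in> fin_signs J" "w \<in> fin_perms J" "g = sign_act \<sigma> \<circ> perm_act w"
      by auto
    obtain G where G: "finite G" "G \<subseteq> J" "inv w permutes G"
      and eq: "pairing J l (weyl_diff g d) = (\<Sum>j\<in>G. l j * (\<sigma> j * d (inv w j) - d j))"
      using pairing_signed_perm[OF w(1,2)] unfolding w(3) by metis
    have "(\<Sum>j\<in>G. \<bar>l j\<bar> * - \<bar>d j\<bar>) \<le> (\<Sum>j\<in>G. \<bar>l j\<bar> * - \<bar>d (inv w j)\<bar>)"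
      using d G(2) by (intro rearrangement_inequality[OF G(1,3)]) auto
    then have "0 \<le> (\<Sum>j\<in>G. \<bar>l j\<bar> * - \<bar>d (inv w j)\<bar> - \<bar>l j\<bar> * - \<bar>d j\<bar>)"
      by (simp only: sum_subtractf)
    also have "\<dots> \<le> (\<Sum>j\<in>G. l j * (\<sigma> j * d (inv w j) - d j))"
    \<comment> \<open>The subtracted terms agree on both sides by the sign condition; the permuted
      terms have equal absolute values, and the left one is nonpositive.\<close>
    proof (rule sum_mono)
      fix j assume "j \<in> G"
      then have "l j * d j \<le> 0"
        using d G(2) by auto
      then have "l j * d j = \<bar>l j\<bar> * - \<bar>d j\<bar>"
        by (simp flip: abs_mult)
      moreover have "\<bar>\<sigma> j\<bar> = 1"
        using w(1) by (auto simp: fin_signs_def dest: spec[of _ j])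
      then have "\<bar>l j * (\<sigma> j * d (inv w j))\<bar> = \<bar>l j\<bar> * \<bar>d (inv w j)\<bar>"
        by (simp add: abs_mult)
      ultimately show "\<bar>l j\<bar> * - \<bar>d (inv w j)\<bar> - \<bar>l j\<bar> * - \<bar>d j\<bar> \<le> l j * (\<sigma> j * d (inv w j) - d j)"
        by (simp add: right_diff_distrib)
    qed
    finally show "0 \<le> pairing J l (weyl_diff g d)"
      by (simp add: eq)
  qed
qed

text \<open>The identity contributes the value 0 to the infimum, which is therefore at most
  0.\<close>

lemma id_in_weyl_group: "id \<in> weyl_group X J"
proof (cases X)
  case Type_A
  have "id = perm_act id"
    by (auto simp: perm_act_def)
  then show ?thesis
    using id_in_fin_perms Type_A by auto
next
  case Type_B
  have "id = sign_act (\<lambda>_. 1) \<circ> perm_act id"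
    by (auto simp: perm_act_def sign_act_def)
  then show ?thesis
    using id_in_fin_perms one_in_fin_signs Type_B by auto
qed

lemma pairing_weyl_diff_id: "pairing J l (weyl_diff id d) = 0"
  by (simp add: pairing_def weyl_diff_def)

theorem proposition5p3:
  fixes J :: "'j set" and l d :: "'j \<Rightarrow> real" and X :: root_type
  assumes "infinite J"
  shows "((INF g \<in> weyl_group X J. ereal (pairing J l (weyl_diff g d))) = 0
            \<longleftrightarrow> (\<forall>g \<in> weyl_group X J. pairing J l (weyl_diff g d) \<ge> 0))
       \<and> ((\<forall>g \<in> weyl_group X J. pairing J l (weyl_diff g d) \<ge> 0)
            \<longleftrightarrow> d \<in> C_min X J l)"
proof (rule conjI)
  let ?inf = "INF g \<in> weyl_group X J. ereal (pairing J l (weyl_diff g d))"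
  have "?inf \<le> 0"
    using INF_lower[OF id_in_weyl_group, of "\<lambda>g. ereal (pairing J l (weyl_diff g d))" X J]
    by (simp add: pairing_weyl_diff_id zero_ereal_def)
  \<comment> \<open>The infimum is taken in the extended reals, so it exists even if the values are
    unbounded below; being at least 0 then means that every value is.\<close>
  then have "?inf = 0 \<longleftrightarrow> 0 \<le> ?inf"
    by auto
  then show "?inf = 0 \<longleftrightarrow> (\<forall>g \<in> weyl_group X J. pairing J l (weyl_diff g d) \<ge> 0)"
    by (simp add: le_INF_iff)
  show "(\<forall>g \<in> weyl_group X J. pairing J l (weyl_diff g d) \<ge> 0) \<longleftrightarrow> d \<in> C_min X J l"
    using nonneg_iff_C_min_A nonneg_iff_C_min_B by (cases X) blast+
qed

end
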